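(* There exists a function $f:\mathbb{N}\to[0,\infty)$ with $\lim_{k\to\infty} f(k)=0$ such that for every integer $k\ge 2$, no (possibly randomized) online algorithm for the fractional online hypergraph matching problem with hyperedges of size at most $k$ is $\frac{1+f(k)}{\ln(k)}$-competitive.
   Context: Fractional online hypergraph matching (edge-arrival model): there is a ground set $I$ of offline vertices; hyperedges $e\subseteq I$ with $|e|\le k$ arrive one at a time in adversarial order (the instance is fixed in advance). On arrival of $e$ the algorithm irrevocably chooses a value $y_e\ge 0$, subject to the constraint that at all times $\sum_{f\ni i} y_f\le 1$ for every $i\in I$ (sum over arrived hyperedges containing $i$). Its value is $\mathrm{ALG}=\sum_e y_e$. $\mathrm{OPT}$ is the optimum of the linear program $\max \sum_{e\in E} x_e$ subject to $\sum_{e\ni i} x_e\le 1$ for all $i\in I$ and $x_e\ge 0$, where $E$ is the set of all hyperedges of the instance. An online algorithm is $c$-competitive if for every instance $\mathbb{E}[\mathrm{ALG}]\ge c\cdot\mathrm{OPT}$. *)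

theory Defs
  imports "HOL-Probability.Probability"
begin

text \<open>
  An instance consists of a finite ground set \<open>I\<close> of offline vertices (labelled by natural
  numbers) and the list \<open>es\<close> of its hyperedges in arrival order. Hyperedges form a set, so the
  list is distinct. Hyperedges are nonempty: an empty one would be subject to no constraint and
  would make the linear program unbounded.
\<close>

definition hypergraph_instance :: "nat \<Rightarrow> nat set \<Rightarrow> nat set list \<Rightarrow> bool" where
  "hypergraph_instance k I es \<longleftrightarrow>
     finite I \<and> distinct es \<and> (\<forall>e\<in>set es. e \<noteq> {} \<and> e \<subseteq> I \<and> card e \<le> k)"

text \<open>
  A deterministic online algorithm is a function \<open>A\<close>: when the last hyperedge of the list \<open>h\<close>
  arrives, it receives the value \<open>A I h\<close>. Thus the value may depend on the ground set and on
  the hyperedges that have arrived so far (which also determine all earlier decisions), but not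
  on the future.
\<close>

type_synonym det_alg = "nat set \<Rightarrow> nat set list \<Rightarrow> real"

definition decision :: "det_alg \<Rightarrow> nat set \<Rightarrow> nat set list \<Rightarrow> nat \<Rightarrow> real" where
  "decision A I es t = A I (take (Suc t) es)"

definition det_online_algorithm :: "nat \<Rightarrow> det_alg \<Rightarrow> bool" where
  "det_online_algorithm k A \<longleftrightarrow>
     (\<forall>I es. hypergraph_instance k I es \<longrightarrow>
        (\<forall>t<length es. 0 \<le> decision A I es t) \<and>
        (\<forall>m\<le>length es. \<forall>i\<in>I. (\<Sum>t | t < m \<and> i \<in> es ! t. decision A I es t) \<le> 1))"

definition alg_value :: "det_alg \<Rightarrow> nat set \<Rightarrow> nat set list \<Rightarrow> real" where
  "alg_value A I es = (\<Sum>t<length es. decision A I es t)"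

definition lp_feasible :: "nat set \<Rightarrow> nat set set \<Rightarrow> (nat set \<Rightarrow> real) \<Rightarrow> bool" where
  "lp_feasible I E x \<longleftrightarrow>
     (\<forall>e\<in>E. 0 \<le> x e) \<and> (\<forall>i\<in>I. (\<Sum>e | e \<in> E \<and> i \<in> e. x e) \<le> 1)"

definition lp_opt :: "nat set \<Rightarrow> nat set set \<Rightarrow> real" where
  "lp_opt I E = Sup {(\<Sum>e\<in>E. x e) | x. lp_feasible I E x}"

text \<open>
  A randomized online algorithm is a probability distribution over deterministic ones, for which
  every decision is a random variable. An algorithm given on an arbitrary probability space is
  covered through its distribution, and a deterministic algorithm through a point mass.
\<close>

definition online_algorithm :: "nat \<Rightarrow> det_alg measure \<Rightarrow> bool" where
  "online_algorithm k M \<longleftrightarrow>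
     prob_space M \<and>
     (\<forall>A\<in>space M. det_online_algorithm k A) \<and>
     (\<forall>I es. hypergraph_instance k I es \<longrightarrow>
        (\<forall>t<length es. (\<lambda>A. decision A I es t) \<in> borel_measurable M))"

definition competitive :: "nat \<Rightarrow> real \<Rightarrow> det_alg measure \<Rightarrow> bool" where
  "competitive k c M \<longleftrightarrow>
     (\<forall>I es. hypergraph_instance k I es \<longrightarrow>
        (\<integral>A. alg_value A I es \<partial>M) \<ge> c * lp_opt I (set es))"

end

theory Submission imports Defs begin

text \<open>
  Take a ground set of \<open>n = k!\<close> vertices and, for each \<open>s = k, k - 1, \<dots>, 1\<close> in this order,
  let the \<open>n / s\<close> blocks of a partition into sets of size \<open>s\<close> arrive. Once all blocks of size at
  least \<open>s\<close> have arrived, the optimum is at least \<open>n / s\<close>, so a \<open>c\<close>-competitive algorithm has put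
  expected value at least \<open>c n / s\<close> on hyperedges of size at least \<open>s\<close>. Summing over \<open>s\<close> counts
  every hyperedge with its size and hence yields the total load of the vertices, which is at most
  \<open>n\<close>. Therefore \<open>c\<close> is at most the reciprocal of the \<open>k\<close>-th harmonic number, which is
  smaller than \<open>1 / ln k\<close>; so \<open>f = 0\<close> already works.
\<close>

text \<open>Pairwise disjoint hyperedges can all get value 1: no vertex lies in two of them, so
  \<open>indicator D\<close> is feasible.\<close>

lemma card_disjoint_le_lp_opt:
  assumes fin: "finite I" "finite E"
    and E: "\<And>e. e \<in> E \<Longrightarrow> e \<noteq> {} \<and> e \<subseteq> I"
    and D: "D \<subseteq> E" "disjoint D"
  shows "real (card D) \<le> lp_opt I E"
proof -
  \<comment> \<open>A real \<open>Sup\<close> dominates its members only if the set is bounded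
    above. Nonempty hyperedges give such a bound: charge \<open>x e\<close> to every vertex of
    \<open>e\<close> and sum the vertex constraints.\<close>
  have "(\<Sum>e\<in>E. x e) \<le> real (card I)" if x: "lp_feasible I E x" for x
  proof -
    have "(\<Sum>e\<in>E. x e) \<le> (\<Sum>e\<in>E. \<Sum>i\<in>{i\<in>I. i \<in> e}. x e)"
    proof (rule sum_mono)
      fix e assume e: "e \<in> E"
      then have "{i\<in>I. i \<in> e} = e" "finite e" "e \<noteq> {}"
        using E[OF e] fin finite_subset by auto
      then have "1 \<le> real (card e)"
        by (simp add: Suc_le_eq card_gt_0_iff)
      moreover have "0 \<le> x e"
        using x e by (simp add: lp_feasible_def)
      ultimately have "1 * x e \<le> real (card e) * x e"
        by (intro mult_right_mono) auto
      then show "x e \<le> (\<Sum>i\<in>{i\<in>I. i \<in> e}. x e)"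
        using \<open>{i\<in>I. i \<in> e} = e\<close> by simp
    qed
    also have "\<dots> = (\<Sum>i\<in>I. \<Sum>e | e \<in> E \<and> i \<in> e. x e)"
      by (rule sum.swap_restrict[OF fin(2,1)])
    also have "\<dots> \<le> (\<Sum>i\<in>I. 1)"
      using x by (intro sum_mono) (simp add: lp_feasible_def)
    finally show ?thesis by simp
  qed
  then have "bdd_above {(\<Sum>e\<in>E. x e) | x. lp_feasible I E x}"
    by (intro bdd_aboveI[of _ "real (card I)"]) auto
  moreover have "lp_feasible I E (indicator D)"
    unfolding lp_feasible_def
  proof (intro conjI ballI)
    fix i assume "i \<in> I"
    have "(\<Sum>e | e \<in> E \<and> i \<in> e. indicator D e :: real) = real (card ({e \<in> E. i \<in> e} \<inter> D))"
      using fin by (simp add: indicator_def)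
    also have "\<dots> \<le> 1"
      using D fin by (auto simp: card_le_Suc0_iff_eq disjoint_def)
    finally show "(\<Sum>e | e \<in> E \<and> i \<in> e. indicator D e :: real) \<le> 1" .
  qed simp
  moreover have "(\<Sum>e\<in>E. indicator D e) = real (card D)"
    using fin D by (simp add: Int_absorb1 indicator_def)
  ultimately show ?thesis
    unfolding lp_opt_def by (intro cSup_upper) (auto intro!: exI[of _ "indicator D"])
qed

lemma ex_partition_into_blocks:
  fixes n s :: nat
  assumes "0 < s" "s dvd n"
  obtains D where "disjoint D" "finite D" "card D = n div s"
    "\<And>e. e \<in> D \<Longrightarrow> e \<subseteq> {..<n} \<and> card e = s"
proof
  define B where "B j = {j * s..<Suc j * s}" for j
  have le: "Suc i * s \<le> j * s" if "i < j" for i j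
    using that by (intro mult_le_mono1) simp
  have disj: "B i \<inter> B j = {}" if "i \<noteq> j" for i j
    using le[of i j] le[of j i] that by (cases i j rule: linorder_cases) (auto simp: B_def)
  have card_B: "card (B j) = s" for j
    by (simp add: B_def)
  have "inj_on B {..<n div s}"
    using disj card_B \<open>0 < s\<close> by (intro inj_onI) (metis Int_absorb card.empty less_irrefl)
  then show "card (B ` {..<n div s}) = n div s"
    by (simp add: card_image)
  show "finite (B ` {..<n div s})"
    by simp
  show "disjoint (B ` {..<n div s})"
    unfolding disjoint_def using disj by (metis imageE)
  show "e \<subseteq> {..<n} \<and> card e = s" if e: "e \<in> B ` {..<n div s}" for e
  proof -
    obtain j where j: "j < n div s" "e = B j"
      using e by auto
    then have "Suc j * s \<le> n"
      using le[OF j(1)] \<open>s dvd n\<close> by simp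
    then show ?thesis
      using card_B j(2) by (auto simp: B_def)
  qed
qed

text \<open>Arrival by decreasing size makes the hyperedges of size above \<open>r\<close> a prefix,
  hence an instance of its own on which \<open>M\<close> must be competitive. Adding these bounds
  over \<open>r\<close> weights each hyperedge by its size, which is how often it enters the total
  vertex load.\<close>

lemma competitive_sum_lp_opt_le:
  assumes M: "online_algorithm k M" "competitive k c M"
    and inst: "hypergraph_instance k I es"
    and sorted: "sorted (rev (map card es))"
  shows "c * (\<Sum>r<k. lp_opt I {e \<in> set es. r < card e}) \<le> real (card I)"
proof -
  interpret prob_space M
    using M(1) by (simp add: online_algorithm_def)
  define L where "L = length es"
  define y where "y t = expectation (\<lambda>A. decision A I es t)" for t
  have fin: "finite I"
    and edge: "\<And>t. t < L \<Longrightarrow> es ! t \<noteq> {} \<and> es ! t \<subseteq> I \<and> card (es ! t) \<le> k"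
    using inst by (auto simp: hypergraph_instance_def L_def)
  have nonneg: "0 \<le> decision A I es t" if "A \<in> space M" "t < L" for A t
    using M(1) inst that by (auto simp: online_algorithm_def det_online_algorithm_def L_def)
  have load: "(\<Sum>t | t < L \<and> i \<in> es ! t. decision A I es t) \<le> 1" if "A \<in> space M" "i \<in> I" for A i
    using M(1) inst that by (auto simp: online_algorithm_def det_online_algorithm_def L_def)
  \<comment> \<open>Any vertex of the nonempty hyperedge caps its value at 1. Integrability is what
    lets expectations commute with the finite sums below.\<close>
  have int: "integrable M (\<lambda>A. decision A I es t)" if t: "t < L" for t
  proof (rule integrable_const_bound[where B = 1])
    obtain i where i: "i \<in> es ! t" "i \<in> I"
      using edge[OF t] by auto
    have "decision A I es t \<le> 1" if "A \<in> space M" for A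
    proof -
      have "decision A I es t \<le> (\<Sum>t | t < L \<and> i \<in> es ! t. decision A I es t)"
        using t i nonneg[OF that] by (intro member_le_sum) auto
      then show ?thesis
        using load[OF that i(2)] by simp
    qed
    then show "AE A in M. norm (decision A I es t) \<le> 1"
      using nonneg t by (intro AE_I2) auto
    show "(\<lambda>A. decision A I es t) \<in> borel_measurable M"
      using M(1) inst t by (auto simp: online_algorithm_def L_def)
  qed
  have exp_load: "(\<Sum>t | t < L \<and> i \<in> es ! t. y t) \<le> 1" if "i \<in> I" for i
  proof -
    have "(\<Sum>t | t < L \<and> i \<in> es ! t. y t) =
        expectation (\<lambda>A. \<Sum>t | t < L \<and> i \<in> es ! t. decision A I es t)"
      unfolding y_def using int by (subst Bochner_Integration.integral_sum) auto
    also have "\<dots> \<le> 1"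
      using int load[OF _ that]
      by (intro integral_le_const Bochner_Integration.integrable_sum AE_I2) auto
    finally show ?thesis .
  qed
  have layer: "c * lp_opt I {e \<in> set es. r < card e} \<le> (\<Sum>t | t < L \<and> r < card (es ! t). y t)"
    for r
  proof -
    define m where "m = length (takeWhile (\<lambda>e. r < card e) es)"
    have m: "m \<le> L"
      by (simp add: m_def L_def length_takeWhile_le)
    \<comment> \<open>\<open>m\<close> is the arrival time at which sizes first drop to
      \<open>r\<close> or below; by sortedness no larger hyperedge follows.\<close>
    have take_m: "take m es = filter (\<lambda>e. r < card e) es"
      using filter_equals_takeWhile_sorted_rev[OF sorted] by (simp add: m_def flip: takeWhile_eq_take)
    have "{t. t < L \<and> r < card (es ! t)} = {..<m}"
    proof (intro set_eqI iffI)
      fix t assume t: "t \<in> {t. t < L \<and> r < card (es ! t)}"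
      show "t \<in> {..<m}"
      proof (rule ccontr)
        assume "t \<notin> {..<m}"
        then have "m \<le> t" by simp
        then have "\<not> r < card (es ! m)"
          using t nth_length_takeWhile[of "\<lambda>e. r < card e" es] by (simp add: m_def L_def)
        moreover have "card (es ! t) \<le> card (es ! m)"
          using sorted_rev_nth_mono[OF sorted \<open>m \<le> t\<close>] t \<open>m \<le> t\<close> by (simp add: L_def)
        ultimately show False
          using t by simp
      qed
    next
      fix t assume "t \<in> {..<m}"
      then have "t < m" by simp
      then have "es ! t \<in> set (take m es)"
        using m by (auto simp: in_set_conv_nth L_def)
      then show "t \<in> {t. t < L \<and> r < card (es ! t)}"
        using \<open>t < m\<close> m by (simp add: take_m)
    qed
    moreover have "hypergraph_instance k I (take m es)"
      using inst by (auto simp: hypergraph_instance_def dest: in_set_takeD)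
    then have "c * lp_opt I (set (take m es)) \<le> expectation (\<lambda>A. alg_value A I (take m es))"
      using M(2) by (simp add: competitive_def)
    \<comment> \<open>The online property: a decision before time \<open>m\<close> reads only
      hyperedges that survive the truncation.\<close>
    moreover have "alg_value A I (take m es) = (\<Sum>t<m. decision A I es t)" for A
      using m by (auto simp: alg_value_def decision_def L_def min_def intro!: sum.cong)
    moreover have "expectation (\<lambda>A. \<Sum>t<m. decision A I es t) = (\<Sum>t<m. y t)"
      unfolding y_def using int m by (intro Bochner_Integration.integral_sum) auto
    ultimately show ?thesis
      by (simp add: take_m)
  qed
  have "c * (\<Sum>r<k. lp_opt I {e \<in> set es. r < card e})
      \<le> (\<Sum>r\<in>{..<k}. \<Sum>t | t \<in> {..<L} \<and> r < card (es ! t). y t)"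
    using layer by (auto simp: sum_distrib_left intro!: sum_mono)
  also have "\<dots> = (\<Sum>t<L. \<Sum>r | r \<in> {..<k} \<and> r < card (es ! t). y t)"
    by (rule sum.swap_restrict) auto
  \<comment> \<open>Both inner sums have \<open>card (es ! t)\<close> equal terms; on the left this
    uses that sizes are at most \<open>k\<close>.\<close>
  also have "\<dots> = (\<Sum>t<L. \<Sum>i | i \<in> I \<and> i \<in> es ! t. y t)"
  proof (rule sum.cong[OF refl])
    fix t assume "t \<in> {..<L}"
    then have "{r. r \<in> {..<k} \<and> r < card (es ! t)} = {..<card (es ! t)}"
      and "{i. i \<in> I \<and> i \<in> es ! t} = es ! t"
      using edge[of t] by auto
    then show "(\<Sum>r | r \<in> {..<k} \<and> r < card (es ! t). y t) = (\<Sum>i | i \<in> I \<and> i \<in> es ! t. y t)"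
      by simp
  qed
  also have "\<dots> = (\<Sum>i\<in>I. \<Sum>t | t \<in> {..<L} \<and> i \<in> es ! t. y t)"
    by (rule sum.swap_restrict) (use fin in auto)
  also have "\<dots> \<le> (\<Sum>i\<in>I. 1)"
    using exp_load by (intro sum_mono) simp
  finally show ?thesis by simp
qed

lemma competitive_harm_le_1:
  assumes M: "online_algorithm k M" "competitive k c M" and "0 \<le> c"
  shows "c * harm k \<le> 1"
proof -
  \<comment> \<open>The factorial is divisible by every size from 1 to \<open>k\<close>; the index
    \<open>r\<close> below stands for size \<open>Suc r\<close>.\<close>
  define n :: nat where "n = fact k"
  have n: "0 < n"
    by (simp add: n_def)
  have dvd: "Suc r dvd n" if "r < k" for r
    unfolding n_def using that by (intro dvd_fact) auto
  have "\<forall>r\<in>{..<k}. \<exists>D. disjoint D \<and> finite D \<and> card D = n div Suc r \<and>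
      (\<forall>e\<in>D. e \<subseteq> {..<n} \<and> card e = Suc r)"
    by (metis dvd ex_partition_into_blocks lessThan_iff zero_less_Suc)
  then obtain D where D: "\<And>r. r < k \<Longrightarrow> disjoint (D r) \<and> finite (D r) \<and>
      card (D r) = n div Suc r \<and> (\<forall>e\<in>D r. e \<subseteq> {..<n} \<and> card e = Suc r)"
    unfolding bchoice_iff by auto
  define E where "E = (\<Union>r<k. D r)"
  have "finite E"
    using D by (simp add: E_def)
  then obtain xs where xs: "set xs = E" "distinct xs"
    using finite_distinct_list by blast
  \<comment> \<open>\<open>sort_key\<close> is ascending, so the reversal makes large hyperedges
    arrive first.\<close>
  define es where "es = rev (sort_key card xs)"
  have set_es: "set es = E"
    by (simp add: es_def xs)
  have edge: "e \<noteq> {} \<and> e \<subseteq> {..<n} \<and> card e \<le> k" if "e \<in> E" for e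
    using that D by (fastforce simp: E_def)
  then have inst: "hypergraph_instance k {..<n} es"
    by (auto simp: hypergraph_instance_def set_es) (simp add: es_def xs)
  have "sorted (rev (map card es))"
    by (simp add: es_def rev_map)
  from competitive_sum_lp_opt_le[OF M inst this]
  have "c * (\<Sum>r<k. lp_opt {..<n} {e \<in> E. r < card e}) \<le> real n"
    by (simp add: set_es)
  moreover have "(\<Sum>r<k. real n / real (Suc r)) \<le> (\<Sum>r<k. lp_opt {..<n} {e \<in> E. r < card e})"
  proof (rule sum_mono)
    fix r assume "r \<in> {..<k}"
    then have r: "r < k" by simp
    \<comment> \<open>The blocks of size exactly \<open>Suc r\<close> serve as the disjoint family
      inside the prefix.\<close>
    have "real (card (D r)) \<le> lp_opt {..<n} {e \<in> E. r < card e}"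
      using D[OF r] edge \<open>finite E\<close> r by (intro card_disjoint_le_lp_opt) (auto simp: E_def)
    then show "real n / real (Suc r) \<le> lp_opt {..<n} {e \<in> E. r < card e}"
      using D[OF r] real_of_nat_div[OF dvd[OF r]] by simp
  qed
  moreover have "(\<Sum>r<k. real n / real (Suc r)) = real n * harm k"
    by (simp add: harm_def sum_distrib_left divide_inverse sum.atLeast1_atMost_eq)
  ultimately have "c * (real n * harm k) \<le> real n"
    using mult_left_mono[OF _ \<open>0 \<le> c\<close>] by fastforce
  then have "real n * (c * harm k) \<le> real n * 1"
    by (simp add: mult_ac)
  then show ?thesis
    using n by simp
qed

theorem theorem5:
  "\<exists>f :: nat \<Rightarrow> real.
     (\<forall>k. 0 \<le> f k) \<and> f \<longlonglongrightarrow> 0 \<and>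
     (\<forall>k\<ge>2. \<not> (\<exists>M. online_algorithm k M \<and> competitive k ((1 + f k) / ln (real k)) M))"
proof (intro exI[of _ "\<lambda>_. 0"] conjI allI impI notI)
  fix k :: nat
  assume k: "2 \<le> k"
    and "\<exists>M. online_algorithm k M \<and> competitive k ((1 + 0) / ln (real k)) M"
  then obtain M where M: "online_algorithm k M" "competitive k (1 / ln (real k)) M"
    by auto
  have pos: "0 < ln (real k)"
    using k by simp
  \<comment> \<open>The shift by 1 supplies the strictness that contradicts
    \<open>c * harm k \<le> 1\<close> for \<open>c = 1 / ln k\<close>.\<close>
  have "ln (real k) < ln (real k + 1)"
    using k by simp
  also have "\<dots> \<le> harm k"
    by (rule ln_le_harm)
  finally have "1 < 1 / ln (real k) * harm k"
    using pos by simp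
  then show False
    using competitive_harm_le_1[OF M] pos by simp
qed simp_all

end
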